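(* Let $X$ be an ordered metric space and let $p\le q$ in $PX$ (stochastic order). Then there exist a sequence $(N_j)_{j\in\mathbb{N}}$ of nonempty finite sets and sequences $(\bar p_j)_{j\in\mathbb{N}}$, $(\bar q_j)_{j\in\mathbb{N}}$ such that: (1) $\bar p_j,\bar q_j\in X^{N_j}$ for all $j$; (2) $i(\bar p_j)\to p$ and $i(\bar q_j)\to q$ in $PX$ (with respect to the Wasserstein metric); (3) $\bar p_j\le\bar q_j$ in the product order of $X^{N_j}$ for all $j$.
   Context: An ordered metric space is a metric space $X$ equipped with a partial order $\le$ whose graph $\{\le\}=\{(x,y): x\le y\}\subseteq X\times X$ is closed. A map between metric spaces is short if it is 1-Lipschitz. $PX$ is the set of Radon probability measures $p$ on $X$ of finite first moment, i.e. such that $\int f\,dp$ exists and is finite for every short $f:X\to\mathbb{R}$. A coupling of $p$ and $q$ is a probability measure on $X\times X$ whose first and second marginals are $p$ and $q$; $\Gamma(p,q)$ is the set of couplings. $PX$ carries the Kantorovich–Wasserstein metric $d(p,q)=\inf_{r\in\Gamma(p,q)}\int d(x,y)\,dr(x,y)$. Stochastic order: for $p,q\in PX$, $p\le q$ if and only if there is a coupling $r$ of $p$ and $q$ supported on the closed set $\{\le\}$ (i.e. the complement of $\{\le\}$ has $r$-measure zero). For a nonempty finite set $N$, $X^N$ is the set of tuples $(x_n)_{n\in N}$ with the product order: $(x_n)\le(y_n)$ iff $x_n\le y_n$ for all $n\in N$. The empirical distribution map $i=i_N:X^N\to PX$ is $i_N((x_n)_{n\in N})=\frac1{|N|}\sum_{n\in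 N}\delta_{x_n}$. *)

theory Defs
  imports "HOL-Probability.Probability"
begin

definition short :: "('a::metric_space \<Rightarrow> real) \<Rightarrow> bool"
  where "short f \<longleftrightarrow> 1-lipschitz_on UNIV f"

text \<open>A finite Borel measure is Radon iff it is inner regular with respect to compact sets.\<close>

definition radon_prob :: "'a::metric_space measure \<Rightarrow> bool"
  where "radon_prob p \<longleftrightarrow> prob_space p \<and> sets p = sets borel \<and>
    (\<forall>A\<in>sets borel. emeasure p A = (SUP K\<in>{K. K \<subseteq> A \<and> compact K}. emeasure p K))"

definition PX :: "'a::metric_space measure set"
  where "PX = {p. radon_prob p \<and> (\<forall>f. short f \<longrightarrow> integrable p f)}"

text \<open>
  Couplings are measures on the Borel sets of the product space.  For a non-separable space this
  \<open>\<sigma>\<close>-algebra may be strictly larger than the product \<open>\<sigma>\<close>-algebra \<open>borel \<Otimes>\<^sub>M borel\<close>, in which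
  the graph of the order and the distance function need not be measurable.
  Couplings of Radon measures are automatically Radon.
\<close>

definition couplings :: "'a::metric_space measure \<Rightarrow> 'a measure \<Rightarrow> ('a \<times> 'a) measure set"
  where "couplings p q = {r. prob_space r \<and> sets r = sets borel \<and>
    distr r borel fst = p \<and> distr r borel snd = q}"

text \<open>
  The infimum is taken in \<open>ennreal\<close>, so that no convention is needed for divergent
  integrals; it is finite for \<open>p\<close> and \<open>q\<close> of finite first moment.
\<close>

definition wasserstein :: "'a::metric_space measure \<Rightarrow> 'a measure \<Rightarrow> ennreal"
  where "wasserstein p q = (INF r\<in>couplings p q. \<integral>\<^sup>+ z. ennreal (dist (fst z) (snd z)) \<partial>r)"

definition stochastic_le :: "'a::{metric_space, order} measure \<Rightarrow> 'a measure \<Rightarrow> bool"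
  where "stochastic_le p q \<longleftrightarrow> (\<exists>r\<in>couplings p q. emeasure r (- {(x, y). x \<le> y}) = 0)"

definition empirical :: "'n set \<Rightarrow> ('n \<Rightarrow> 'a::metric_space) \<Rightarrow> 'a measure"
  where "empirical N x = measure_of UNIV (sets borel)
    (\<lambda>A. 1 / of_nat (card N) * (\<Sum>n\<in>N. emeasure (return borel (x n)) A))"

lemma sets_empirical [simp, measurable_cong]: "sets (empirical N x) = sets borel"
  by (simp add: empirical_def sigma_algebra.sets_measure_of_eq[OF sets.sigma_algebra_axioms[of borel, simplified]])

lemma space_empirical [simp]: "space (empirical N x) = UNIV"
  by (simp add: empirical_def space_measure_of_conv)

lemma emeasure_empirical:
  fixes x :: "'n \<Rightarrow> 'a::metric_space"
  assumes "A \<in> sets borel"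
  shows "emeasure (empirical N x) A =
    1 / of_nat (card N) * (\<Sum>n\<in>N. emeasure (return borel (x n)) A)"
  unfolding empirical_def
proof (rule emeasure_measure_of_sigma[OF _ _ _ assms])
  show "sigma_algebra UNIV (sets (borel :: 'a measure))"
    using sets.sigma_algebra_axioms[of "borel :: 'a measure"] by simp
  show "positive (sets borel) (\<lambda>A. 1 / of_nat (card N) * (\<Sum>n\<in>N. emeasure (return borel (x n)) A))"
    by (simp add: positive_def)
  show "countably_additive (sets borel)
      (\<lambda>A. 1 / of_nat (card N) * (\<Sum>n\<in>N. emeasure (return borel (x n)) A))"
  proof (rule countably_additiveI)
    fix F :: "nat \<Rightarrow> 'a set"
    assume F: "range F \<subseteq> sets borel" "disjoint_family F"
    have "(\<Sum>i. 1 / of_nat (card N) * (\<Sum>n\<in>N. emeasure (return borel (x n)) (F i))) =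
        1 / of_nat (card N) * (\<Sum>n\<in>N. \<Sum>i. emeasure (return borel (x n)) (F i))"
      by (subst ennreal_suminf_cmult, subst suminf_sum) auto
    also have "\<dots> = 1 / of_nat (card N) * (\<Sum>n\<in>N. emeasure (return borel (x n)) (\<Union>i. F i))"
      using F by (subst suminf_emeasure) (auto simp: sets_return)
    finally show "(\<Sum>i. 1 / of_nat (card N) * (\<Sum>n\<in>N. emeasure (return borel (x n)) (F i))) =
        1 / of_nat (card N) * (\<Sum>n\<in>N. emeasure (return borel (x n)) (\<Union>i. F i))" .
  qed
qed

lemma empirical_in_PX:
  fixes x :: "'n \<Rightarrow> 'a::metric_space"
  assumes "finite N" "N \<noteq> {}"
  shows "empirical N x \<in> PX"
proof -
  have card: "1 / of_nat (card N) * of_nat (card N) = (1::ennreal)"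
    using assms by (subst ennreal_divide_times) (auto intro!: ennreal_divide_self simp: less_top[symmetric])
  interpret prob_space "empirical N x"
    by (rule prob_spaceI) (use card in \<open>simp add: emeasure_empirical\<close>)
  have fin: "emeasure (empirical N x) A = emeasure (empirical N x) (A \<inter> x ` N)"
    if A: "A \<in> sets borel" for A
  proof -
    have "A \<inter> x ` N \<in> sets borel"
      using A assms by (intro sets.Int borel_closed finite_imp_closed) auto
    then show ?thesis
      using A by (auto simp: emeasure_empirical indicator_def intro!: arg_cong2[where f="(*)"] sum.cong)
  qed
  have "radon_prob (empirical N x)"
    unfolding radon_prob_def
  proof (intro conjI ballI)
    show "prob_space (empirical N x)" by unfold_locales
    show "sets (empirical N x) = sets borel" by simp
    fix A :: "'a set" assume A: "A \<in> sets borel"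
    show "emeasure (empirical N x) A =
        (SUP K\<in>{K. K \<subseteq> A \<and> compact K}. emeasure (empirical N x) K)"
    proof (rule antisym)
      show "emeasure (empirical N x) A \<le> (SUP K\<in>{K. K \<subseteq> A \<and> compact K}. emeasure (empirical N x) K)"
        using assms by (subst fin[OF A]) (auto intro!: SUP_upper finite_imp_compact)
      show "(SUP K\<in>{K. K \<subseteq> A \<and> compact K}. emeasure (empirical N x) K) \<le> emeasure (empirical N x) A"
        using A by (auto intro!: SUP_least emeasure_mono)
    qed
  qed
  moreover have "integrable (empirical N x) f" if "short f" for f
  proof -
    have "continuous_on UNIV f"
      using that lipschitz_on_continuous_on unfolding short_def by blast
    then have [measurable]: "f \<in> borel_measurable borel"
      by (rule borel_measurable_continuous_onI)
    have N: "UNIV - x ` N \<in> sets borel"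
      using assms by (intro borel_open open_Diff finite_imp_closed) auto
    have "emeasure (empirical N x) (UNIV - x ` N) = emeasure (empirical N x) {}"
      by (subst fin[OF N]) (rule arg_cong[where f="emeasure _"], auto)
    then have "AE y in empirical N x. y \<in> x ` N"
      by (intro AE_I'[of "UNIV - x ` N"]) (use N in \<open>auto simp: null_sets_def\<close>)
    then have "AE y in empirical N x. norm (f y) \<le> (\<Sum>z\<in>x ` N. norm (f z))"
      by eventually_elim (rule member_le_sum, use assms in auto)
    then show ?thesis
      by (intro integrable_const_bound) auto
  qed
  ultimately show ?thesis by (simp add: PX_def)
qed

end

theory Submission
  imports Defs
begin

text \<open>
  Let \<open>r\<close> be a coupling of \<open>p\<close> and \<open>q\<close> concentrated on the graph of the order. It is a tight
  probability measure of finite first moment on the product space, and it suffices to approximate \<open>r\<close>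
  itself in the Wasserstein metric by empirical distributions of points of the graph, because the
  two projections are short. Up to a small tail, \<open>r\<close> lives on a compact subset of the graph;
  cutting this set into finitely many small pieces and collapsing each piece to one of its neighbouring
  points moves \<open>r\<close> to a finitely supported measure on the graph, whose weights are then rounded to
  rational numbers with a common denominator.
\<close>

section \<open>Wasserstein estimates for push-forwards\<close>

text \<open>The joint law of the two variables is an admissible coupling. One variable factors
  through an index in \<open>nat\<close> because the space may be non-separable: the pair is then
  Borel measurable by pasting over the countably many values of \<open>J\<close>, whereas two
  arbitrary Borel maps need not form a Borel map into the product.\<close>

lemma wasserstein_distr_le:
  fixes c :: "nat \<Rightarrow> 'b::metric_space"
  assumes "prob_space M"
    and J: "J \<in> measurable M (count_space UNIV)" and f: "f \<in> measurable M borel"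
  shows "wasserstein (distr M borel (\<lambda>\<omega>. c (J \<omega>))) (distr M borel f) \<le>
    (\<integral>\<^sup>+ \<omega>. ennreal (dist (c (J \<omega>)) (f \<omega>)) \<partial>M)"
proof -
  interpret prob_space M by fact
  have pair: "(\<lambda>\<omega>. (c (J \<omega>), f \<omega>)) \<in> measurable M borel"
  proof (rule measurable_compose_countable[where f="\<lambda>k \<omega>. (c k, f \<omega>)", OF _ J])
    fix k
    have "Pair (c k) \<in> borel_measurable borel"
      by (intro borel_measurable_continuous_onI continuous_intros)
    from measurable_compose[OF f this] show "(\<lambda>\<omega>. (c k, f \<omega>)) \<in> measurable M borel" .
  qed
  have [measurable]: "fst \<in> borel_measurable (borel :: ('b \<times> 'b) measure)"
    "snd \<in> borel_measurable (borel :: ('b \<times> 'b) measure)"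
    by (intro borel_measurable_continuous_onI continuous_intros)+
  have [measurable]: "(\<lambda>z::'b \<times> 'b. dist (fst z) (snd z)) \<in> borel_measurable borel"
    by (intro borel_measurable_continuous_onI continuous_intros)
  let ?r = "distr M borel (\<lambda>\<omega>. (c (J \<omega>), f \<omega>))"
  have "?r \<in> couplings (distr M borel (\<lambda>\<omega>. c (J \<omega>))) (distr M borel f)"
    using pair by (simp add: couplings_def prob_space_distr distr_distr o_def)
  then have "wasserstein (distr M borel (\<lambda>\<omega>. c (J \<omega>))) (distr M borel f) \<le>
      (\<integral>\<^sup>+ z. ennreal (dist (fst z) (snd z)) \<partial>?r)"
    unfolding wasserstein_def by (rule INF_lower)
  also have "\<dots> = (\<integral>\<^sup>+ \<omega>. ennreal (dist (c (J \<omega>)) (f \<omega>)) \<partial>M)"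
    using pair by (subst nn_integral_distr) auto
  finally show ?thesis .
qed

text \<open>Every coupling can be pushed forward along \<open>f\<close> in both coordinates, and
  shortness keeps its cost from growing. This transfers convergence from the product space to the
  marginals, with \<open>f\<close> a projection.\<close>

lemma wasserstein_distr_short_le:
  fixes f :: "'b::metric_space \<Rightarrow> 'a::metric_space"
  assumes f: "1-lipschitz_on UNIV f"
  shows "wasserstein (distr \<mu> borel f) (distr \<nu> borel f) \<le> wasserstein \<mu> \<nu>"
  unfolding wasserstein_def[of \<mu> \<nu>]
proof (rule INF_greatest)
  fix r assume r: "r \<in> couplings \<mu> \<nu>"
  then interpret prob_space r by (simp add: couplings_def)
  have [measurable_cong]: "sets r = sets borel" and \<mu>: "\<mu> = distr r borel fst" and \<nu>: "\<nu> = distr r borel snd"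
    using r by (auto simp: couplings_def)
  have cont: "continuous_on A f" for A
    using f by (meson continuous_on_subset lipschitz_on_continuous_on subset_UNIV)
  have [measurable]: "f \<in> borel_measurable borel"
    by (intro borel_measurable_continuous_onI cont)
  have [measurable]: "fst \<in> borel_measurable (borel :: ('c::metric_space \<times> 'c) measure)"
    "snd \<in> borel_measurable (borel :: ('c \<times> 'c) measure)"
    by (intro borel_measurable_continuous_onI continuous_intros)+
  have [measurable]: "(\<lambda>z. (f (fst z), f (snd z))) \<in> borel_measurable (borel :: ('b \<times> 'b) measure)"
    by (intro borel_measurable_continuous_onI continuous_intros continuous_on_compose2[OF cont[of UNIV]]) auto
  have [measurable]: "(\<lambda>z::'a \<times> 'a. dist (fst z) (snd z)) \<in> borel_measurable borel"
    by (intro borel_measurable_continuous_onI continuous_intros)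
  let ?r = "distr r borel (\<lambda>z. (f (fst z), f (snd z)))"
  have "?r \<in> couplings (distr \<mu> borel f) (distr \<nu> borel f)"
    unfolding \<mu> \<nu> by (simp add: couplings_def prob_space_distr distr_distr o_def)
  then have "wasserstein (distr \<mu> borel f) (distr \<nu> borel f) \<le> (\<integral>\<^sup>+ z. ennreal (dist (fst z) (snd z)) \<partial>?r)"
    unfolding wasserstein_def by (rule INF_lower)
  also have "\<dots> = (\<integral>\<^sup>+ z. ennreal (dist (f (fst z)) (f (snd z))) \<partial>r)"
    by (subst nn_integral_distr) auto
  also have "\<dots> \<le> (\<integral>\<^sup>+ z. ennreal (dist (fst z) (snd z)) \<partial>r)"
    using lipschitz_onD[OF f] by (intro nn_integral_mono ennreal_leI) simp
  finally show "wasserstein (distr \<mu> borel f) (distr \<nu> borel f) \<le> \<dots>" .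
qed

lemma distr_empirical:
  fixes f :: "'b::metric_space \<Rightarrow> 'a::metric_space"
  assumes [measurable]: "f \<in> borel_measurable borel"
  shows "distr (empirical N x) borel f = empirical N (\<lambda>n. f (x n))"
proof (rule measure_eqI)
  fix A assume "A \<in> sets (distr (empirical N x) borel f)"
  then have [measurable]: "A \<in> sets borel" by simp
  have "f -` A \<in> sets borel"
    using measurable_sets[of f borel borel A] by simp
  then show "emeasure (distr (empirical N x) borel f) A = emeasure (empirical N (\<lambda>n. f (x n))) A"
    by (simp add: emeasure_distr emeasure_empirical indicator_def)
qed simp

lemma empirical_cong:
  assumes "\<And>n. n \<in> N \<Longrightarrow> x n = y n"
  shows "empirical N x = empirical N y"
  by (rule measure_eqI) (use assms in \<open>auto simp: emeasure_empirical intro!: arg_cong2[where f="(*)"] sum.cong\<close>)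

section \<open>Tightness and quantization by finitely many points\<close>

text \<open>Phrased through complements, so that it passes from two marginals to a coupling by a
  union bound.\<close>

definition tight_measure :: "'b::metric_space measure \<Rightarrow> bool"
  where "tight_measure r \<longleftrightarrow> (\<forall>\<delta>>0. \<exists>K. compact K \<and> emeasure r (- K) \<le> ennreal \<delta>)"

text \<open>The measure with density \<open>f\<close> is finite and absolutely continuous with
  respect to \<open>r\<close>. Compact sets exhaust the space up to an \<open>r\<close>-null set, so
  continuity from above makes the tail of the density measure small.\<close>

lemma tight_tail_integral:
  fixes r :: "'b::metric_space measure" and f :: "'b \<Rightarrow> ennreal"
  assumes tight: "tight_measure r" and sets[measurable_cong]: "sets r = sets borel"
    and f[measurable]: "f \<in> borel_measurable r" and fin: "(\<integral>\<^sup>+ z. f z \<partial>r) < \<infinity>" and "\<epsilon> > 0"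
  obtains K where "compact K" "(\<integral>\<^sup>+ z. f z * indicator (- K) z \<partial>r) < \<epsilon>"
proof -
  have "\<exists>K. compact K \<and> emeasure r (- K) \<le> ennreal (inverse (real (Suc n)))" for n
    using tight unfolding tight_measure_def by (rule allE) auto
  then obtain K where K: "\<And>n. compact (K n)"
      and rK: "\<And>n. emeasure r (- K n) \<le> ennreal (inverse (real (Suc n)))"
    by metis
  have [measurable]: "K n \<in> sets borel" for n
    using K by (intro borel_closed compact_imp_closed)
  \<comment> \<open>Finite unions keep compactness and make the complements decrease, as continuity
    from above requires.\<close>
  define L where "L n = (\<Union>i\<le>n. K i)" for n
  have L: "compact (L n)" for n
    unfolding L_def by (intro compact_UN K) auto
  have [measurable]: "L n \<in> sets borel" for n
    using L by (intro borel_closed compact_imp_closed)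
  have space: "space r = UNIV"
    using sets_eq_imp_space_eq[OF sets] by simp
  let ?\<nu> = "density r f"
  have null: "emeasure r (\<Inter>n. - L n) = 0"
  proof -
    have "emeasure r (\<Inter>n. - L n) \<le> ennreal (inverse (real (Suc n)))" for n
    proof -
      have "emeasure r (\<Inter>n. - L n) \<le> emeasure r (- K n)"
        by (rule emeasure_mono) (auto simp: L_def)
      then show ?thesis using rK order_trans by blast
    qed
    moreover have "(\<lambda>n. ennreal (inverse (real (Suc n)))) \<longlonglongrightarrow> ennreal 0"
      by (intro tendsto_ennrealI LIMSEQ_inverse_real_of_nat)
    ultimately have "emeasure r (\<Inter>n. - L n) \<le> ennreal 0"
      by (intro LIMSEQ_le_const) auto
    then show ?thesis by simp
  qed
  then have "(\<Inter>n. - L n) \<in> null_sets r"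
    by (intro null_setsI) (auto simp: sets)
  then have AE: "AE z in r. z \<notin> (\<Inter>n. - L n)"
    by (rule AE_not_in)
  have "emeasure ?\<nu> (\<Inter>n. - L n) = 0"
    using AE by (subst emeasure_density) (auto intro!: nn_integral_0_iff_AE[THEN iffD2])
  moreover have "(\<lambda>n. emeasure ?\<nu> (- L n)) \<longlonglongrightarrow> emeasure ?\<nu> (\<Inter>n. - L n)"
  proof (rule Lim_emeasure_decseq)
    show "decseq (\<lambda>n. - L n)"
      unfolding L_def decseq_def by (auto intro: order_trans)
    show "emeasure ?\<nu> (- L n) \<noteq> \<infinity>" for n
    proof -
      have "emeasure ?\<nu> (- L n) \<le> emeasure ?\<nu> (space ?\<nu>)"
        by (rule emeasure_space)
      also have "\<dots> < \<infinity>"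
        using fin by (simp add: emeasure_density cong: nn_integral_cong)
      finally show ?thesis by simp
    qed
  qed (auto simp: sets)
  ultimately have "\<forall>\<^sub>F n in sequentially. emeasure ?\<nu> (- L n) < \<epsilon>"
    using \<open>\<epsilon> > 0\<close> by (auto dest: order_tendstoD)
  then obtain n where "emeasure ?\<nu> (- L n) < \<epsilon>"
    by (auto simp: eventually_sequentially)
  then show ?thesis
    using L[of n] by (intro that) (auto simp: emeasure_density)
qed

text \<open>On \<open>K \<inter> G\<close> a finite net gives error at most
  \<open>\<epsilon> / 2\<close>; all other points go to \<open>z0\<close>, and off \<open>K\<close>
  this costs only the tail of the first moment. Net and \<open>z0\<close> both lie in
  \<open>G\<close>, so the new points stay in \<open>G\<close>.\<close>

lemma finite_quantization:
  fixes r :: "'b::metric_space measure"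
  assumes "prob_space r" and tight: "tight_measure r" and sets[measurable_cong]: "sets r = sets borel"
    and G: "closed G" "emeasure r (- G) = 0" and z0: "z0 \<in> G"
    and fin: "(\<integral>\<^sup>+ z. ennreal (dist z0 z) \<partial>r) < \<infinity>" and "\<epsilon> > 0"
  obtains m :: nat and i :: "'b \<Rightarrow> nat" and c :: "nat \<Rightarrow> 'b"
  where "i \<in> measurable r (count_space UNIV)" "\<And>z. i z \<le> m" "\<And>k. c k \<in> G"
    "(\<integral>\<^sup>+ z. ennreal (dist (c (i z)) z) \<partial>r) \<le> ennreal \<epsilon>"
proof -
  interpret prob_space r by fact
  have space: "space r = UNIV"
    using sets_eq_imp_space_eq[OF sets] by simp
  have [measurable]: "(\<lambda>z. dist z0 z) \<in> borel_measurable borel"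
    by (intro borel_measurable_continuous_onI continuous_intros)
  obtain K where K: "compact K"
    and tail: "(\<integral>\<^sup>+ z. ennreal (dist z0 z) * indicator (- K) z \<partial>r) < ennreal (\<epsilon> / 2)"
    using tight_tail_integral[OF tight sets _ fin, of "ennreal (\<epsilon> / 2)"] \<open>\<epsilon> > 0\<close> by auto
  have KG: "compact (K \<inter> G)"
    using K G(1) by (rule compact_Int_closed)
  then have [measurable]: "K \<inter> G \<in> sets borel" "K \<in> sets borel" "G \<in> sets borel"
    using K G by (auto intro!: borel_closed compact_imp_closed)
  obtain F where F: "finite F" "F \<subseteq> K \<inter> G" "K \<inter> G \<subseteq> (\<Union>x\<in>F. ball x (\<epsilon> / 2))"
    using seq_compact_imp_totally_bounded[of "K \<inter> G"] KG half_gt_zero[OF \<open>\<epsilon> > 0\<close>]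
    unfolding compact_eq_seq_compact_metric by blast
  obtain m :: nat and c0 where c0: "F = c0 ` {..<m}"
    using finite_imp_nat_seg_image_inj_on[OF F(1)] by (elim exE conjE) (rule that, simp only: lessThan_def)
  \<comment> \<open>Index \<open>m\<close> stands for the default point \<open>z0\<close>; letting
    all larger indices do so too puts every \<open>c k\<close> in \<open>G\<close>.\<close>
  define c where "c k = (if k < m then c0 k else z0)" for k
  \<comment> \<open>Taking the least index turns the overlapping balls into disjoint measurable
    pieces.\<close>
  define i where "i z = (if z \<in> K \<inter> G then LEAST k. z \<in> ball (c k) (\<epsilon> / 2) else m)" for z
  have near: "z \<in> ball (c (i z)) (\<epsilon> / 2)" "i z < m" if z: "z \<in> K \<inter> G" for z
  proof -
    obtain k where k: "k < m" "z \<in> ball (c k) (\<epsilon> / 2)"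
      using F(3) z unfolding c0 c_def by fastforce
    then show "z \<in> ball (c (i z)) (\<epsilon> / 2)"
      using z by (auto simp: i_def simp del: mem_ball intro: LeastI)
    show "i z < m"
      using k z Least_le[of "\<lambda>k. z \<in> ball (c k) (\<epsilon> / 2)" k] by (auto simp: i_def simp del: mem_ball)
  qed
  show ?thesis
  proof (rule that)
    have [measurable]: "Measurable.pred borel (\<lambda>z. z \<in> ball (c k) (\<epsilon> / 2))" for k
      using borel_open[OF open_ball[of "c k" "\<epsilon> / 2"]] by (simp add: pred_def del: mem_ball)
    show "i \<in> measurable r (count_space UNIV)"
      unfolding i_def by measurable
    show "i z \<le> m" for z
      using near(2)[of z] by (cases "z \<in> K \<inter> G") (auto simp: i_def)
    show "c k \<in> G" for k
      using F(2) z0 by (auto simp: c_def c0)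
    have "AE z in r. z \<in> G"
      using G(2) by (intro AE_I[where N="- G"]) (auto simp: sets)
    \<comment> \<open>Points of \<open>K\<close> outside \<open>G\<close> also go to
      \<open>z0\<close>, with no bound on their cost, but they form a null set.\<close>
    then have "AE z in r. ennreal (dist (c (i z)) z) \<le>
        ennreal (\<epsilon> / 2) + ennreal (dist z0 z) * indicator (- K) z"
    proof eventually_elim
      case (elim z)
      show ?case
      proof (cases "z \<in> K")
        case True
        then show ?thesis
          using near(1)[of z] elim by (auto intro!: ennreal_leI)
      next
        case False
        then show ?thesis by (simp add: i_def c_def)
      qed
    qed
    then have "(\<integral>\<^sup>+ z. ennreal (dist (c (i z)) z) \<partial>r) \<le>
        (\<integral>\<^sup>+ z. ennreal (\<epsilon> / 2) + ennreal (dist z0 z) * indicator (- K) z \<partial>r)"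
      by (rule nn_integral_mono_AE)
    also have "\<dots> = ennreal (\<epsilon> / 2) + (\<integral>\<^sup>+ z. ennreal (dist z0 z) * indicator (- K) z \<partial>r)"
      by (subst nn_integral_add) (auto simp: emeasure_space_1)
    also have "\<dots> \<le> ennreal (\<epsilon> / 2) + ennreal (\<epsilon> / 2)"
      using tail by (intro add_left_mono) simp
    also have "\<dots> = ennreal \<epsilon>"
      using \<open>\<epsilon> > 0\<close> by (simp flip: ennreal_plus)
    finally show "(\<integral>\<^sup>+ z. ennreal (dist (c (i z)) z) \<partial>r) \<le> ennreal \<epsilon>" .
  qed
qed

section \<open>Rational weights with a common denominator\<close>

text \<open>List each point \<open>c k\<close> exactly \<open>a k\<close> times. A bijection of
  \<open>{..<N}\<close> with the pairs \<open>(k, l)\<close>, \<open>l < a k\<close>, orders this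
  list, and \<open>t\<close> reads off the first component.\<close>

lemma distr_eq_empirical:
  fixes c :: "nat \<Rightarrow> 'b::metric_space" and a :: "nat \<Rightarrow> nat"
  assumes "prob_space M" and J[measurable]: "J \<in> measurable M (count_space UNIV)"
    and Jm: "\<And>\<omega>. J \<omega> \<le> m" and N: "N > 0" "(\<Sum>k\<le>m. a k) = N"
    and a: "\<And>k. k \<le> m \<Longrightarrow> measure M {\<omega> \<in> space M. J \<omega> = k} = real (a k) / real N"
  obtains t :: "nat \<Rightarrow> nat"
  where "distr M borel (\<lambda>\<omega>. c (J \<omega>)) = empirical {..<N} (\<lambda>n. c (t n))"
proof -
  interpret prob_space M by fact
  let ?S = "SIGMA k:{..m}. {..<a k}"
  have "card ?S = N"
    using N by simp
  then obtain h where h: "bij_betw h {..<N} ?S"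
    using ex_bij_betw_nat_finite[of ?S] by (auto simp: atLeast0LessThan)
  have [measurable]: "(\<lambda>\<omega>. c (J \<omega>)) \<in> borel_measurable M"
    using measurable_compose[OF J, of c borel] by simp
  show ?thesis
  proof (rule that[of "\<lambda>n. fst (h n)"], rule measure_eqI)
    fix A assume "A \<in> sets (distr M borel (\<lambda>\<omega>. c (J \<omega>)))"
    then have A[measurable]: "A \<in> sets borel" by simp
    have "emeasure (distr M borel (\<lambda>\<omega>. c (J \<omega>))) A = emeasure M {\<omega> \<in> space M. c (J \<omega>) \<in> A}"
      by (subst emeasure_distr) (auto intro!: arg_cong[where f="emeasure M"])
    also have "{\<omega> \<in> space M. c (J \<omega>) \<in> A} = (\<Union>k\<in>{k. k \<le> m \<and> c k \<in> A}. {\<omega> \<in> space M. J \<omega> = k})"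
      using Jm by auto
    also have "emeasure M \<dots> = (\<Sum>k\<in>{k. k \<le> m \<and> c k \<in> A}. emeasure M {\<omega> \<in> space M. J \<omega> = k})"
      by (subst sum_emeasure) (auto simp: disjoint_family_on_def)
    also have "\<dots> = (\<Sum>k\<in>{k. k \<le> m \<and> c k \<in> A}. ennreal (real (a k) / real N))"
      by (intro sum.cong) (auto simp: emeasure_eq_measure a)
    also have "\<dots> = (\<Sum>k\<le>m. ennreal (real (a k) / real N) * indicator A (c k))"
      by (rule sum.mono_neutral_cong_left) (auto simp: indicator_def)
    \<comment> \<open>The weight \<open>a k / N\<close> is split into \<open>a k\<close> atoms of
      mass \<open>1 / N\<close>.\<close>
    also have "\<dots> = (\<Sum>k\<le>m. \<Sum>l<a k. 1 / of_nat N * indicator A (c k))"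
    proof (rule sum.cong)
      fix k
      have "ennreal (real (a k) / real N) = of_nat (a k) * (1 / of_nat N)"
        using N(1) by (simp add: divide_ennreal[symmetric] ennreal_of_nat_eq_real_of_nat ennreal_times_divide)
      then show "ennreal (real (a k) / real N) * indicator A (c k) =
          (\<Sum>l<a k. 1 / of_nat N * indicator A (c k))"
        by (simp add: mult.assoc)
    qed simp
    also have "\<dots> = (\<Sum>(k, l)\<in>?S. 1 / of_nat N * indicator A (c k))"
      by (subst sum.Sigma) auto
    also have "\<dots> = (\<Sum>n<N. 1 / of_nat N * indicator A (c (fst (h n))))"
      by (subst sum.reindex_bij_betw[OF h, symmetric]) (simp add: case_prod_beta)
    also have "\<dots> = emeasure (empirical {..<N} (\<lambda>n. c (fst (h n)))) A"
      by (simp add: emeasure_empirical sum_distrib_left)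
    finally show "emeasure (distr M borel (\<lambda>\<omega>. c (J \<omega>))) A = \<dots>" .
  qed simp
qed

text \<open>
  The weights of the index \<open>i\<close> are rounded down to multiples of \<open>1 / N\<close>: an independent uniform
  variable decides whether a point keeps its index or is moved to the default index \<open>m\<close>, so at most
  \<open>m / N\<close> of the mass moves.
\<close>

lemma rational_rounding:
  fixes r :: "'b::metric_space measure" and c :: "nat \<Rightarrow> 'b"
  assumes "prob_space r" and sets[measurable_cong]: "sets r = sets borel"
    and i[measurable]: "i \<in> measurable r (count_space UNIV)" and im: "\<And>z. i z \<le> m" and N: "N > 0"
    and D: "\<And>k. k \<le> m \<Longrightarrow> dist (c m) (c k) \<le> D"
  obtains t :: "nat \<Rightarrow> nat"
  where "wasserstein (empirical {..<N} (\<lambda>n. c (t n))) r \<le>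
    (\<integral>\<^sup>+ z. ennreal (dist (c (i z)) z) \<partial>r) + ennreal (D * (m / N))"
proof -
  interpret r: prob_space r by fact
  define U where "U = uniform_measure lborel {0..1::real}"
  interpret U: prob_space U
    unfolding U_def by (rule prob_space_uniform_measure) auto
  have setsU[measurable_cong]: "sets U = sets borel" by (simp add: U_def)
  have spaceU: "space U = UNIV" by (simp add: U_def)
  have space: "space r = UNIV"
    using sets_eq_imp_space_eq[OF sets] by simp
  interpret M: pair_prob_space r U ..
  define w where "w k = measure r {z. i z = k}" for k
  define a where "a k = nat \<lfloor>real N * w k\<rfloor>" for k
  \<comment> \<open>The conditional probability of keeping index \<open>k\<close>, chosen so that
    the kept mass is exactly \<open>a k / N\<close>. If \<open>w k = 0\<close>, division by zero
    gives \<open>\<theta> k = 0\<close>, which is consistent because then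
    \<open>a k = 0\<close>.\<close>
  define \<theta> where "\<theta> k = real (a k) / (real N * w k)" for k
  define J where "J \<omega> = (if snd \<omega> < \<theta> (i (fst \<omega>)) then i (fst \<omega>) else m)" for \<omega> :: "'b \<times> real"
  have w0: "w k \<ge> 0" for k by (simp add: w_def)
  have a_le: "real (a k) \<le> real N * w k" "real N * w k \<le> real (a k) + 1" for k
    using w0[of k] unfolding a_def by (auto simp: of_nat_nat intro: real_of_int_floor_add_one_ge)
  have \<theta>: "0 \<le> \<theta> k" "\<theta> k \<le> 1" for k
    using a_le(1)[of k] w0[of k] by (auto simp: \<theta>_def divide_le_eq_1 zero_less_mult_iff)
  have w\<theta>: "w k * \<theta> k = real (a k) / real N" for k
    using a_le(1)[of k] N by (cases "w k = 0") (auto simp: \<theta>_def)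
  have J[measurable]: "J \<in> measurable (r \<Otimes>\<^sub>M U) (count_space UNIV)"
    unfolding J_def by measurable
  have Jm: "J \<omega> \<le> m" for \<omega>
    by (simp add: J_def im)
  have U: "measure U {..<\<theta> k} = \<theta> k" for k
  proof -
    have "{0..1} \<inter> {..<\<theta> k} = {0..<\<theta> k}"
      using \<theta>[of k] by auto
    then have "emeasure U {..<\<theta> k} = ennreal (\<theta> k)"
      using \<theta>[of k] divide_ennreal[of "\<theta> k" 1] by (simp add: U_def)
    then show ?thesis
      using \<theta>[of k] by (simp add: measure_def)
  qed
  \<comment> \<open>For \<open>k < m\<close> the event is a rectangle. Index \<open>m\<close> is
    excluded because it also receives all moved points.\<close>
  have MJ: "measure (r \<Otimes>\<^sub>M U) {\<omega>. J \<omega> = k} = real (a k) / real N" if "k < m" for k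
  proof -
    have "{\<omega>. J \<omega> = k} = {z. i z = k} \<times> {..<\<theta> k}"
      using that by (auto simp: J_def split: if_splits)
    moreover have "{z. i z = k} \<in> sets r"
      using measurable_sets[OF i, of "{k}"] by (simp add: space vimage_def)
    ultimately have "measure (r \<Otimes>\<^sub>M U) {\<omega>. J \<omega> = k} = w k * measure U {..<\<theta> k}"
      using U.emeasure_pair_measure_Times[of "{z. i z = k}" r "{..<\<theta> k}"] setsU
      by (simp add: measure_def w_def enn2real_mult)
    then show ?thesis
      using U w\<theta> by simp
  qed
  have Mi: "measure (r \<Otimes>\<^sub>M U) {\<omega>. i (fst \<omega>) = k} = w k" for k
  proof -
    have "{\<omega>. i (fst \<omega>) = k} = {z. i z = k} \<times> (UNIV :: real set)"
      by auto
    moreover have "{z. i z = k} \<in> sets r"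
      using measurable_sets[OF i, of "{k}"] by (simp add: space vimage_def)
    ultimately show ?thesis
      using U.emeasure_pair_measure_Times[of "{z. i z = k}" r UNIV] setsU U.emeasure_space_1
      by (simp add: measure_def w_def spaceU)
  qed
  have spaceM: "space (r \<Otimes>\<^sub>M U) = UNIV"
    by (simp add: space_pair_measure space spaceU)
  have Jk[measurable]: "{\<omega>. J \<omega> = k} \<in> sets (r \<Otimes>\<^sub>M U)" for k
    using measurable_sets[OF J, of "{k}"] by (simp add: spaceM vimage_def)
  have "measure (r \<Otimes>\<^sub>M U) (\<Union>k\<le>m. {\<omega>. J \<omega> = k}) = (\<Sum>k\<le>m. measure (r \<Otimes>\<^sub>M U) {\<omega>. J \<omega> = k})"
    by (intro M.finite_measure_finite_Union) (auto simp: disjoint_family_on_def)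
  moreover have "(\<Union>k\<le>m. {\<omega>. J \<omega> = k}) = UNIV"
    using Jm by auto
  ultimately have total: "(\<Sum>k<m. real (a k) / real N) + measure (r \<Otimes>\<^sub>M U) {\<omega>. J \<omega> = m} = 1"
    using M.prob_space MJ by (simp add: spaceM lessThan_Suc_atMost[symmetric])
  then have "(\<Sum>k<m. real (a k)) / real N \<le> 1"
    using measure_nonneg[of "r \<Otimes>\<^sub>M U" "{\<omega>. J \<omega> = m}"] by (simp add: sum_divide_distrib[symmetric] del: measure_nonneg)
  then have "real (\<Sum>k<m. a k) \<le> real N"
    using N by (simp add: divide_le_eq_1)
  then have sum_le: "(\<Sum>k<m. a k) \<le> N"
    by linarith
  \<comment> \<open>Index \<open>m\<close> absorbs the remaining mass. The bound
    \<open>sum_le\<close> ensures that the subtraction in \<open>nat\<close> does not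
    truncate.\<close>
  define b where "b = a(m := N - (\<Sum>k<m. a k))"
  have bsum: "(\<Sum>k\<le>m. b k) = N"
    using sum_le by (simp add: b_def lessThan_Suc_atMost[symmetric])
  have "measure (r \<Otimes>\<^sub>M U) {\<omega> \<in> space (r \<Otimes>\<^sub>M U). J \<omega> = k} = real (b k) / real N" if "k \<le> m" for k
  proof (cases "k = m")
    case True
    have "real (N - (\<Sum>k<m. a k)) / real N = 1 - (\<Sum>k<m. real (a k) / real N)"
      using sum_le N by (simp add: of_nat_diff diff_divide_distrib sum_divide_distrib)
    then show ?thesis
      using total True by (simp add: b_def spaceM)
  qed (use that MJ in \<open>simp add: b_def spaceM\<close>)
  then obtain t where t: "distr (r \<Otimes>\<^sub>M U) borel (\<lambda>\<omega>. c (J \<omega>)) = empirical {..<N} (\<lambda>n. c (t n))"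
    using distr_eq_empirical[OF M.prob_space_axioms J Jm N bsum] by blast
  define B where "B = {\<omega>. J \<omega> \<noteq> i (fst \<omega>)}"
  have ik[measurable]: "{\<omega>. i (fst \<omega>) = k} \<in> sets (r \<Otimes>\<^sub>M U)" for k
    using measurable_sets[OF measurable_compose[OF measurable_fst i], of "{k}" U] by (simp add: spaceM vimage_def)
  have B[measurable]: "B \<in> sets (r \<Otimes>\<^sub>M U)"
  proof -
    have "B = space (r \<Otimes>\<^sub>M U) - (\<Union>k\<le>m. {\<omega>. i (fst \<omega>) = k} \<inter> {\<omega>. J \<omega> = k})"
      using im by (auto simp: B_def spaceM)
    then show ?thesis
      using ik Jk by (auto intro!: sets.Diff sets.finite_UN)
  qed
  have "measure (r \<Otimes>\<^sub>M U) B \<le> (\<Sum>k<m. measure (r \<Otimes>\<^sub>M U) ({\<omega>. i (fst \<omega>) = k} - {\<omega>. J \<omega> = k}))"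
  proof -
    \<comment> \<open>A point with index \<open>m\<close> keeps it in either case, so only indices
      below \<open>m\<close> can lose mass.\<close>
    have "B \<subseteq> (\<Union>k<m. {\<omega>. i (fst \<omega>) = k} - {\<omega>. J \<omega> = k})"
      using im by (auto simp: B_def J_def le_less split: if_splits)
    then have "measure (r \<Otimes>\<^sub>M U) B \<le> measure (r \<Otimes>\<^sub>M U) (\<Union>k<m. {\<omega>. i (fst \<omega>) = k} - {\<omega>. J \<omega> = k})"
      using ik by (intro M.finite_measure_mono) auto
    also have "\<dots> \<le> (\<Sum>k<m. measure (r \<Otimes>\<^sub>M U) ({\<omega>. i (fst \<omega>) = k} - {\<omega>. J \<omega> = k}))"
      using ik by (intro M.finite_measure_subadditive_finite) auto
    finally show ?thesis .
  qed
  also have "\<dots> \<le> (\<Sum>k<m. 1 / real N)"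
  proof (rule sum_mono)
    fix k assume "k \<in> {..<m}"
    then have k: "k < m" by simp
    \<comment> \<open>The mass lost at \<open>k\<close> is \<open>w k - a k / N\<close>, the
      rounding error of the floor, hence at most \<open>1 / N\<close>.\<close>
    have "{\<omega>. J \<omega> = k} \<subseteq> {\<omega>. i (fst \<omega>) = k}"
      using k by (auto simp: J_def split: if_splits)
    then have "measure (r \<Otimes>\<^sub>M U) ({\<omega>. i (fst \<omega>) = k} - {\<omega>. J \<omega> = k}) = w k - real (a k) / real N"
      using k by (subst M.finite_measure_Diff) (auto simp: MJ Mi spaceM)
    also have "\<dots> \<le> 1 / real N"
      using divide_right_mono[OF a_le(2)[of k], of "real N"] N by (simp add: add_divide_distrib)
    finally show "measure (r \<Otimes>\<^sub>M U) ({\<omega>. i (fst \<omega>) = k} - {\<omega>. J \<omega> = k}) \<le> 1 / real N" .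
  qed
  finally have MB: "measure (r \<Otimes>\<^sub>M U) B \<le> m / N"
    by simp
  have D0: "D \<ge> 0"
    using D[of m] by simp
  have fst: "fst \<in> measurable (r \<Otimes>\<^sub>M U) borel"
    by (subst measurable_cong_sets[OF refl sets[symmetric]]) (rule measurable_fst)
  have dst: "distr (r \<Otimes>\<^sub>M U) borel fst = r"
  proof (rule measure_eqI)
    fix A assume "A \<in> sets (distr (r \<Otimes>\<^sub>M U) borel fst)"
    then have A: "A \<in> sets r" by (simp add: sets)
    have "fst -` A \<inter> space (r \<Otimes>\<^sub>M U) = A \<times> space U"
      by (auto simp: spaceM spaceU)
    then show "emeasure (distr (r \<Otimes>\<^sub>M U) borel fst) A = emeasure r A"
      using A fst by (simp add: emeasure_distr sets U.emeasure_pair_measure_Times U.emeasure_space_1)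
  qed (simp add: sets)
  have [measurable]: "(\<lambda>z. dist (c (i z)) z) \<in> borel_measurable r"
  proof (rule measurable_compose_countable[where f="\<lambda>k z. dist (c k) z", OF _ i])
    fix k
    have "(\<lambda>z. dist (c k) z) \<in> borel_measurable borel"
      by (intro borel_measurable_continuous_onI continuous_intros)
    then show "(\<lambda>z. dist (c k) z) \<in> borel_measurable r" by measurable
  qed
  \<comment> \<open>On the enlarged space, \<open>c (J \<omega>)\<close> has the empirical law and
    \<open>fst\<close> has law \<open>r\<close>, so the pair is a coupling.\<close>
  have "wasserstein (empirical {..<N} (\<lambda>n. c (t n))) r \<le>
      (\<integral>\<^sup>+ \<omega>. ennreal (dist (c (J \<omega>)) (fst \<omega>)) \<partial>(r \<Otimes>\<^sub>M U))"
    using wasserstein_distr_le[OF M.prob_space_axioms J fst, of c] unfolding t dst .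
  \<comment> \<open>Moved points land at \<open>c m\<close>; the triangle inequality through
    \<open>c (i (fst \<omega>))\<close> charges them at most \<open>D\<close> extra.\<close>
  also have "\<dots> \<le> (\<integral>\<^sup>+ \<omega>. ennreal (dist (c (i (fst \<omega>))) (fst \<omega>)) + ennreal D * indicator B \<omega> \<partial>(r \<Otimes>\<^sub>M U))"
  proof (rule nn_integral_mono)
    fix \<omega>
    have "dist (c (J \<omega>)) (fst \<omega>) \<le> dist (c (i (fst \<omega>))) (fst \<omega>) + D" if "\<omega> \<in> B"
    proof -
      have "J \<omega> = m"
        using that by (auto simp: B_def J_def split: if_splits)
      then show ?thesis
        using dist_triangle[of "c m" "fst \<omega>" "c (i (fst \<omega>))"] D[OF im[of "fst \<omega>"]] by simp
    qed
    then show "ennreal (dist (c (J \<omega>)) (fst \<omega>)) \<le>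
        ennreal (dist (c (i (fst \<omega>))) (fst \<omega>)) + ennreal D * indicator B \<omega>"
      using D0 by (cases "\<omega> \<in> B") (auto simp: B_def simp flip: ennreal_plus intro!: ennreal_leI)
  qed
  also have "\<dots> = (\<integral>\<^sup>+ \<omega>. ennreal (dist (c (i (fst \<omega>))) (fst \<omega>)) \<partial>(r \<Otimes>\<^sub>M U)) + ennreal D * emeasure (r \<Otimes>\<^sub>M U) B"
    by (subst nn_integral_add) (auto simp: nn_integral_cmult_indicator)
  also have "(\<integral>\<^sup>+ \<omega>. ennreal (dist (c (i (fst \<omega>))) (fst \<omega>)) \<partial>(r \<Otimes>\<^sub>M U)) = (\<integral>\<^sup>+ z. ennreal (dist (c (i z)) z) \<partial>r)"
    by (subst U.nn_integral_fst[symmetric]) (auto simp: U.emeasure_space_1)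
  also have "ennreal D * emeasure (r \<Otimes>\<^sub>M U) B \<le> ennreal (D * (m / N))"
    unfolding M.emeasure_eq_measure ennreal_mult'[OF D0, symmetric]
    by (intro ennreal_leI mult_left_mono MB D0)
  finally show ?thesis
    by (rule that) (auto intro: add_left_mono)
qed

text \<open>The order of choices matters: quantization with error \<open>\<epsilon> / 2\<close>
  fixes \<open>m\<close> and the points \<open>c k\<close>, hence \<open>D\<close>, and only then is
  the denominator taken large enough for the rounding cost \<open>D * m / N\<close> to be at most
  \<open>\<epsilon> / 2\<close>.\<close>

lemma empirical_approximation:
  fixes r :: "'b::metric_space measure"
  assumes "prob_space r" "tight_measure r" "sets r = sets borel" "closed G" "emeasure r (- G) = 0" "z0 \<in> G"
    and "(\<integral>\<^sup>+ z. ennreal (dist z0 z) \<partial>r) < \<infinity>" and "\<epsilon> > 0"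
  obtains N :: nat and \<tau> :: "nat \<Rightarrow> 'b"
  where "N > 0" "\<And>n. \<tau> n \<in> G" "wasserstein (empirical {..<N} \<tau>) r \<le> ennreal \<epsilon>"
proof -
  obtain m :: nat and i :: "'b \<Rightarrow> nat" and c :: "nat \<Rightarrow> 'b"
    where i: "i \<in> measurable r (count_space UNIV)" "\<And>z. i z \<le> m" and c: "\<And>k. c k \<in> G"
      and int: "(\<integral>\<^sup>+ z. ennreal (dist (c (i z)) z) \<partial>r) \<le> ennreal (\<epsilon> / 2)"
    by (rule finite_quantization[OF assms(1-7) half_gt_zero[OF \<open>\<epsilon> > 0\<close>]]) blast
  define D where "D = (\<Sum>k\<le>m. dist (c m) (c k))"
  have D: "dist (c m) (c k) \<le> D" if "k \<le> m" for k
    unfolding D_def using that by (intro member_le_sum) auto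
  obtain N0 :: nat where "D * m / (\<epsilon> / 2) < N0"
    using reals_Archimedean2 by blast
  then have N: "D * (m / Suc N0) \<le> \<epsilon> / 2"
    using \<open>\<epsilon> > 0\<close> by (simp add: field_simps)
  obtain t where t: "wasserstein (empirical {..<Suc N0} (\<lambda>n. c (t n))) r \<le>
      (\<integral>\<^sup>+ z. ennreal (dist (c (i z)) z) \<partial>r) + ennreal (D * (m / Suc N0))"
    by (rule rational_rounding[where c=c, OF assms(1,3) i zero_less_Suc D])
  have "\<dots> \<le> ennreal (\<epsilon> / 2) + ennreal (\<epsilon> / 2)"
    using int N by (intro add_mono ennreal_leI)
  also have "\<dots> = ennreal \<epsilon>"
    using \<open>\<epsilon> > 0\<close> by (simp flip: ennreal_plus)
  finally show ?thesis
    using t c by (intro that[of "Suc N0" "\<lambda>n. c (t n)"]) auto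
qed

section \<open>Tightness and first moments of couplings\<close>

lemma radon_prob_compact:
  assumes p: "radon_prob p" and "\<delta> > 0"
  obtains K where "compact K" "emeasure p (- K) \<le> ennreal \<delta>"
proof -
  interpret prob_space p using p by (simp add: radon_prob_def)
  have sets: "sets p = sets borel" using p by (simp add: radon_prob_def)
  have space: "space p = UNIV" using sets_eq_imp_space_eq[OF sets] by simp
  have "emeasure p UNIV = (SUP K\<in>{K. K \<subseteq> UNIV \<and> compact K}. emeasure p K)"
    using p unfolding radon_prob_def by (metis UNIV_I sets.top space_borel)
  then have "(SUP K\<in>{K. compact K}. emeasure p K) = 1"
    using emeasure_space_1 by (simp add: space)
  \<comment> \<open>For \<open>\<delta> > 1\<close> the left side is truncated to 0, so no case
    distinction arises.\<close>
  moreover have "ennreal (1 - \<delta>) < 1"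
    using \<open>\<delta> > 0\<close> by simp
  ultimately obtain K where K: "compact K" "ennreal (1 - \<delta>) < emeasure p K"
    by (metis (mono_tags, lifting) less_SUP_iff mem_Collect_eq)
  have "K \<in> sets p"
    using K by (auto simp: sets intro!: borel_closed compact_imp_closed)
  then have "measure p (- K) = 1 - measure p K"
    using prob_compl[of K] by (simp add: space Compl_eq_Diff_UNIV)
  moreover have "1 - \<delta> < measure p K"
    using K(2) unfolding emeasure_eq_measure by (meson ennreal_leI linorder_not_le)
  ultimately have "emeasure p (- K) \<le> ennreal \<delta>"
    by (simp add: emeasure_eq_measure ennreal_leI)
  with K that show ?thesis by blast
qed

text \<open>The complement of \<open>K \<times> L\<close> is the union of the cylinders over
  \<open>- K\<close> and \<open>- L\<close>, whose masses are read off the marginals.\<close>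

lemma tight_coupling:
  fixes p q :: "'a::metric_space measure"
  assumes p: "radon_prob p" and q: "radon_prob q" and r: "r \<in> couplings p q"
  shows "tight_measure r"
  unfolding tight_measure_def
proof (intro allI impI)
  fix \<delta> :: real assume "\<delta> > 0"
  obtain K where K: "compact K" "emeasure p (- K) \<le> ennreal (\<delta> / 2)"
    using radon_prob_compact[OF p, of "\<delta> / 2"] \<open>\<delta> > 0\<close> by auto
  obtain L where L: "compact L" "emeasure q (- L) \<le> ennreal (\<delta> / 2)"
    using radon_prob_compact[OF q, of "\<delta> / 2"] \<open>\<delta> > 0\<close> by auto
  have sets: "sets r = sets borel" and p_eq: "p = distr r borel fst" and q_eq: "q = distr r borel snd"
    using r by (auto simp: couplings_def)
  have space: "space r = UNIV" using sets_eq_imp_space_eq[OF sets] by simp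
  have "(fst :: 'a \<times> 'a \<Rightarrow> 'a) \<in> borel_measurable borel" "(snd :: 'a \<times> 'a \<Rightarrow> 'a) \<in> borel_measurable borel"
    by (intro borel_measurable_continuous_onI continuous_intros)+
  then have m: "fst \<in> borel_measurable r" "snd \<in> borel_measurable r"
    by (simp_all cong: measurable_cong_sets add: sets)
  have [measurable]: "- K \<in> sets borel" "- L \<in> sets borel"
    using K L by (auto intro!: borel_open open_Compl compact_imp_closed)
  have sets2: "fst -` (- K) \<in> sets r" "snd -` (- L) \<in> sets r"
    using measurable_sets[OF m(1), of "- K"] measurable_sets[OF m(2), of "- L"] by (simp_all add: space)
  have "- (K \<times> L) = fst -` (- K) \<union> snd -` (- L)"
    by auto
  then have "emeasure r (- (K \<times> L)) \<le> emeasure r (fst -` (- K)) + emeasure r (snd -` (- L))"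
    using sets2 by (simp add: emeasure_subadditive)
  also have "\<dots> = emeasure p (- K) + emeasure q (- L)"
    unfolding p_eq q_eq using m by (simp add: emeasure_distr space)
  also have "\<dots> \<le> ennreal (\<delta> / 2) + ennreal (\<delta> / 2)"
    using K L by (intro add_mono)
  also have "\<dots> = ennreal \<delta>"
    using \<open>\<delta> > 0\<close> by (simp flip: ennreal_plus)
  finally show "\<exists>K. compact K \<and> emeasure r (- K) \<le> ennreal \<delta>"
    using K L by (blast intro: compact_Times)
qed

text \<open>The distance to a fixed point is itself a short function.\<close>

lemma PX_first_moment:
  assumes "p \<in> PX"
  shows "(\<integral>\<^sup>+ x. ennreal (dist x0 x) \<partial>p) < \<infinity>"
proof -
  have "short (dist x0)"
    unfolding short_def
    by (rule lipschitz_onI) (use abs_dist_diff_le[where b=x0] in \<open>simp_all add: dist_real_def dist_commute[of x0]\<close>)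
  then have "integrable p (dist x0)"
    using assms by (simp add: PX_def)
  then show ?thesis
    by (simp add: integrable_iff_bounded)
qed

text \<open>The Euclidean product distance is at most the sum of the coordinate distances, whose
  integrals are first moments of the marginals.\<close>

lemma coupling_first_moment:
  fixes p q :: "'a::metric_space measure"
  assumes p: "p \<in> PX" and q: "q \<in> PX" and r: "r \<in> couplings p q"
  shows "(\<integral>\<^sup>+ z. ennreal (dist (x0, y0) z) \<partial>r) < \<infinity>"
proof -
  have [measurable_cong]: "sets r = sets borel" and p_eq: "p = distr r borel fst" and q_eq: "q = distr r borel snd"
    using r by (auto simp: couplings_def)
  have [measurable]: "(fst :: 'a \<times> 'a \<Rightarrow> 'a) \<in> borel_measurable borel" "(snd :: 'a \<times> 'a \<Rightarrow> 'a) \<in> borel_measurable borel"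
    "dist x \<in> borel_measurable borel" for x :: 'a
    by (intro borel_measurable_continuous_onI continuous_intros)+
  have "dist (x0, y0) z \<le> dist x0 (fst z) + dist y0 (snd z)" for z :: "'a \<times> 'a"
    by (simp add: dist_prod_def sqrt_sum_squares_le_sum)
  then have "(\<integral>\<^sup>+ z. ennreal (dist (x0, y0) z) \<partial>r) \<le>
      (\<integral>\<^sup>+ z. ennreal (dist x0 (fst z)) + ennreal (dist y0 (snd z)) \<partial>r)"
    by (intro nn_integral_mono) (simp flip: ennreal_plus add: ennreal_leI)
  also have "\<dots> = (\<integral>\<^sup>+ z. ennreal (dist x0 (fst z)) \<partial>r) + (\<integral>\<^sup>+ z. ennreal (dist y0 (snd z)) \<partial>r)"
    by (rule nn_integral_add) measurable
  also have "\<dots> = (\<integral>\<^sup>+ x. ennreal (dist x0 x) \<partial>p) + (\<integral>\<^sup>+ y. ennreal (dist y0 y) \<partial>q)"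
    unfolding p_eq q_eq by (simp add: nn_integral_distr)
  also have "\<dots> < \<infinity>"
    using PX_first_moment[OF p] PX_first_moment[OF q] by simp
  finally show ?thesis .
qed

section \<open>From the coupling to its two marginals\<close>

theorem proposition3p3p1:
  fixes p q :: "'a::{metric_space, order} measure"
  assumes "closed {(x :: 'a, y). x \<le> y}"
    and "p \<in> PX" and "q \<in> PX" and "stochastic_le p q"
  shows "\<exists>(N :: nat \<Rightarrow> nat set) (pbar :: nat \<Rightarrow> nat \<Rightarrow> 'a) (qbar :: nat \<Rightarrow> nat \<Rightarrow> 'a).
    (\<forall>j. finite (N j) \<and> N j \<noteq> {}) \<and>
    (\<forall>j. pbar j \<in> N j \<rightarrow>\<^sub>E UNIV \<and> qbar j \<in> N j \<rightarrow>\<^sub>E UNIV) \<and>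
    (\<lambda>j. wasserstein (empirical (N j) (pbar j)) p) \<longlonglongrightarrow> 0 \<and>
    (\<lambda>j. wasserstein (empirical (N j) (qbar j)) q) \<longlonglongrightarrow> 0 \<and>
    (\<forall>j. \<forall>n\<in>N j. pbar j n \<le> qbar j n)"
proof -
  let ?G = "{(x :: 'a, y). x \<le> y}"
  obtain r where r: "r \<in> couplings p q" and G: "emeasure r (- ?G) = 0"
    using assms(4) unfolding stochastic_le_def by blast
  have prob: "prob_space r" and sets: "sets r = sets borel"
    and p_eq: "p = distr r borel fst" and q_eq: "q = distr r borel snd"
    using r by (auto simp: couplings_def)
  have tight: "tight_measure r"
    using assms(2,3) r by (auto simp: PX_def intro: tight_coupling)
  have "\<exists>N \<tau>. N > (0::nat) \<and> (\<forall>n::nat. \<tau> n \<in> ?G) \<and>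
      wasserstein (empirical {..<N} \<tau>) r \<le> ennreal (inverse (real (Suc j)))" for j
    \<comment> \<open>An arbitrary diagonal point serves as base point; it lies on the graph by
      reflexivity.\<close>
    by (rule empirical_approximation[OF prob tight sets assms(1) G, of "(undefined, undefined)"
          "inverse (real (Suc j))"])
      (use coupling_first_moment[OF assms(2,3) r] in auto)
  then obtain N \<tau> where N: "\<And>j. N j > (0::nat)" and \<tau>: "\<And>j (n::nat). \<tau> j n \<in> ?G"
    and W: "\<And>j. wasserstein (empirical {..<N j} (\<tau> j)) r \<le> ennreal (inverse (real (Suc j)))"
    by metis
  \<comment> \<open>Stated for any short \<open>f\<close> so as to serve both projections.
    \<open>restrict\<close> puts the tuples into the extensional function space without changing
    their empirical distribution.\<close>
  have lim: "(\<lambda>j. wasserstein (empirical {..<N j} (restrict (\<lambda>n. f (\<tau> j n)) {..<N j})) (distr r borel f)) \<longlonglongrightarrow> 0"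
    if f: "1-lipschitz_on UNIV f" for f :: "'a \<times> 'a \<Rightarrow> 'a"
  proof (rule tendsto_sandwich[OF always_eventually always_eventually tendsto_const])
    show "\<forall>j. wasserstein (empirical {..<N j} (restrict (\<lambda>n. f (\<tau> j n)) {..<N j})) (distr r borel f) \<le>
        ennreal (inverse (real (Suc j)))"
    proof
      fix j
      have "f \<in> borel_measurable borel"
        using f by (intro borel_measurable_continuous_onI lipschitz_on_continuous_on)
      then have "empirical {..<N j} (restrict (\<lambda>n. f (\<tau> j n)) {..<N j}) = distr (empirical {..<N j} (\<tau> j)) borel f"
        by (subst distr_empirical) (auto intro: empirical_cong)
      then show "wasserstein (empirical {..<N j} (restrict (\<lambda>n. f (\<tau> j n)) {..<N j})) (distr r borel f) \<le>
          ennreal (inverse (real (Suc j)))"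
        using wasserstein_distr_short_le[OF f] W[of j] by (metis order_trans)
    qed
    show "(\<lambda>j. ennreal (inverse (real (Suc j)))) \<longlonglongrightarrow> 0"
      using tendsto_ennrealI[OF LIMSEQ_inverse_real_of_nat] by simp
  qed simp
  have "1-lipschitz_on UNIV (fst :: 'a \<times> 'a \<Rightarrow> 'a)" "1-lipschitz_on UNIV (snd :: 'a \<times> 'a \<Rightarrow> 'a)"
    unfolding lipschitz_on_def mult_1 using dist_fst_le dist_snd_le zero_le_one by blast+
  note lims = this[THEN lim, folded p_eq q_eq]
  \<comment> \<open>Each sample point lies on the graph of the order, which is exactly the
    coordinatewise comparison.\<close>
  have le: "fst (\<tau> j n) \<le> snd (\<tau> j n)" for j n
    using \<tau>[of j n] by (auto simp: case_prod_beta)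
  show ?thesis
    by (intro exI[of _ "\<lambda>j. {..<N j}"] exI[of _ "\<lambda>j. restrict (\<lambda>n. fst (\<tau> j n)) {..<N j}"]
        exI[of _ "\<lambda>j. restrict (\<lambda>n. snd (\<tau> j n)) {..<N j}"] conjI lims)
      (use N le in auto)
qed

end
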